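(* Let $p$ be an odd prime, let $m>1$ be an odd integer, let $q=p^m$, and let $D=\{x\in \mathrm{GF}(q)^*: \mathrm{Tr}(x^2)=0\}=\{d_1,\ldots,d_n\}$. Then the set $$\mathcal{C}_D=\{(\mathrm{Tr}(xd_1),\mathrm{Tr}(xd_2),\ldots,\mathrm{Tr}(xd_n)): x\in \mathrm{GF}(q)\}$$ is a linear code over $\mathrm{GF}(p)$ of length $n=p^{m-1}-1$ and dimension $m$, and its weight distribution is - $A_0=1$; - $A_w=\frac{p-1}{2}\left(p^{m-1}+p^{\frac{m-1}{2}}\right)$ for $w=(p-1)\left(p^{m-2}-p^{\frac{m-3}{2}}\right)$; - $A_w=p^{m-1}-1$ for $w=(p-1)p^{m-2}$; - $A_w=\frac{p-1}{2}\left(p^{m-1}-p^{\frac{m-1}{2}}\right)$ for $w=(p-1)\left(p^{m-2}+p^{\frac{m-3}{2}}\right)$; and $A_w=0$ for all other weights $w$.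
   Context: $\mathrm{GF}(q)$ is the finite field with $q$ elements, $\mathrm{GF}(q)^*$ its multiplicative group, and $\mathrm{Tr}$ is the trace function from $\mathrm{GF}(q)$ onto $\mathrm{GF}(p)$. The elements $d_1,\ldots,d_n$ of $D$ are distinct and listed in any fixed order. A linear code of length $n$ and dimension $k$ over $\mathrm{GF}(p)$ is a $k$-dimensional subspace of $\mathrm{GF}(p)^n$; $A_w$ denotes the number of codewords of Hamming weight $w$ in the code. *)

theory Defs
  imports "Berlekamp_Zassenhaus.Finite_Field" "Jordan_Normal_Form.VS_Connect"
begin

text \<open>
  The prime field GF(p) is \<open>'p mod_ring\<close> with \<open>CARD('p) = p\<close>; the field GF(q) is any finite field
  type \<open>'q\<close> with \<open>CARD('q) = p ^ m\<close>. The map \<open>gf_emb\<close> is the inclusion of GF(p) into GF(q)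
  (a ring homomorphism when GF(q) has characteristic p).
\<close>

definition gf_emb :: "'p::prime_card mod_ring \<Rightarrow> 'q::finite_field" where
  "gf_emb a = of_int (to_int_mod_ring a)"

text \<open>
  The trace from GF(p^m) onto GF(p), i.e. the sum of the conjugates of x under the Frobenius
  automorphism, regarded as an element of GF(p). The definite description is well defined when
  \<open>CARD('q) = CARD('p) ^ m\<close>, see \<open>gf_emb_gf_trace\<close> below.
\<close>

definition gf_trace :: "nat \<Rightarrow> 'q::finite_field \<Rightarrow> 'p::prime_card mod_ring" where
  "gf_trace m x = (THE c. (gf_emb c :: 'q) = (\<Sum>i<m. x ^ (CARD('p) ^ i)))"

lemma CHAR_eq_of_CARD:
  assumes "CARD('q::finite_field) = CARD('p::prime_card) ^ m"
  shows "CHAR('q) = CARD('p)"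
proof -
  have "CHAR('q) dvd CARD('p) ^ m"
    using CHAR_dvd_CARD[where ?'a='q] assms by simp
  moreover have "prime CHAR('q)" by simp
  ultimately have "CHAR('q) dvd CARD('p)" using prime_dvd_power by blast
  with \<open>prime CHAR('q)\<close> show ?thesis
    using primes_dvd_imp_eq prime_card[where ?'a='p] by blast
qed

lemma inj_gf_emb:
  assumes "CHAR('q::finite_field) = CARD('p::prime_card)"
  shows "inj (gf_emb :: 'p mod_ring \<Rightarrow> 'q)"
proof (rule injI)
  fix a b :: "'p mod_ring"
  assume "(gf_emb a :: 'q) = gf_emb b"
  then have "(of_int (to_int_mod_ring a - to_int_mod_ring b) :: 'q) = 0"
    by (simp add: gf_emb_def)
  then have "int CARD('p) dvd to_int_mod_ring a - to_int_mod_ring b"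
    using assms by (simp only: of_int_eq_0_iff_char_dvd)
  moreover have "to_int_mod_ring a \<in> {0..<int CARD('p)}" "to_int_mod_ring b \<in> {0..<int CARD('p)}"
    using range_to_int_mod_ring[where ?'a='p] by blast+
  ultimately have "to_int_mod_ring a = to_int_mod_ring b"
    by (metis atLeastLessThan_iff mod_eq_dvd_iff mod_pos_pos_trivial)
  then show "a = b" by simp
qed

lemma range_gf_emb:
  assumes "CHAR('q::finite_field) = CARD('p::prime_card)"
  shows "range (gf_emb :: 'p mod_ring \<Rightarrow> 'q) = {y. y ^ CARD('p) = y}"
proof (rule card_subset_eq)
  have p: "prime CARD('p)" by (rule prime_card)
  then have p1: "CARD('p) > 1" by (rule prime_gt_1_nat)
  show "finite {y :: 'q. y ^ CARD('p) = y}" by simp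
  have *: "(of_nat n :: 'q) ^ CARD('p) = of_nat n" for n
  proof (induction n)
    case 0
    show ?case using p1 by (simp add: power_0_left)
  next
    case (Suc n)
    have "(of_nat n + 1 :: 'q) ^ CARD('p) = of_nat n ^ CARD('p) + 1 ^ CARD('p)"
      by (rule freshmans_dream) (use p assms in auto)
    with Suc show ?case by (simp add: add.commute)
  qed
  have "(gf_emb a :: 'q) ^ CARD('p) = gf_emb a" for a :: "'p mod_ring"
  proof -
    have "to_int_mod_ring a \<in> {0..<int CARD('p)}"
      using range_to_int_mod_ring[where ?'a='p] by blast
    then have "gf_emb a = (of_nat (nat (to_int_mod_ring a)) :: 'q)"
      by (simp add: gf_emb_def)
    then show ?thesis by (simp only: *)
  qed
  then show sub: "range (gf_emb :: 'p mod_ring \<Rightarrow> 'q) \<subseteq> {y. y ^ CARD('p) = y}"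
    by blast
  let ?P = "monom 1 CARD('p) - monom 1 1 :: 'q poly"
  have c: "coeff ?P CARD('p) = 1" using p1 by simp
  then have ne: "?P \<noteq> 0" by (metis coeff_0 zero_neq_one)
  have deg: "degree ?P \<le> CARD('p)"
    using p1 by (intro degree_diff_le) (auto intro: order.trans[OF degree_monom_le])
  have "{y :: 'q. y ^ CARD('p) = y} = {y. poly ?P y = 0}" by (simp add: poly_monom)
  then have "card {y :: 'q. y ^ CARD('p) = y} \<le> CARD('p)"
    using card_poly_roots_bound[OF ne] deg by simp
  moreover have "card (range (gf_emb :: 'p mod_ring \<Rightarrow> 'q)) = CARD('p)"
    using card_image[OF inj_gf_emb[OF assms]] by simp
  moreover have "card (range (gf_emb :: 'p mod_ring \<Rightarrow> 'q)) \<le> card {y :: 'q. y ^ CARD('p) = y}"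
    by (rule card_mono[OF _ sub]) simp
  ultimately show "card (range (gf_emb :: 'p mod_ring \<Rightarrow> 'q)) = card {y :: 'q. y ^ CARD('p) = y}"
    by linarith
qed

lemma gf_emb_gf_trace:
  fixes x :: "'q::finite_field"
  assumes "CARD('q) = CARD('p::prime_card) ^ m"
  shows "gf_emb (gf_trace m x :: 'p mod_ring) = (\<Sum>i<m. x ^ (CARD('p) ^ i))"
proof -
  have ch: "CHAR('q) = CARD('p)" by (rule CHAR_eq_of_CARD[OF assms])
  have p: "prime CARD('p)" by (rule prime_card)
  define f where "f i = x ^ (CARD('p) ^ i)" for i
  have shift: "f i ^ CARD('p) = f (Suc i)" for i
    by (simp only: f_def power_mult[symmetric] power_Suc2)
  have f_m: "f m = f 0"
    using finite_field_power_card_eq_same[of x] by (simp add: f_def assms)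
  have "sum f {..<m} ^ CARD('p) = (\<Sum>i<m. f i ^ CARD('p))"
    by (rule freshmans_dream_sum) (simp_all only: ch p)
  also have "\<dots> = (\<Sum>i<m. f (Suc i))"
    by (simp only: shift)
  also have "\<dots> = sum f {..<m}"
    using sum.lessThan_Suc_shift[of f m] sum.lessThan_Suc[of f m] f_m by simp
  finally have "sum f {..<m} \<in> range (gf_emb :: 'p mod_ring \<Rightarrow> 'q)"
    by (simp add: range_gf_emb[OF ch])
  then obtain c :: "'p mod_ring" where c: "sum f {..<m} = gf_emb c" by (rule rangeE)
  then have "gf_trace m x = c"
    unfolding gf_trace_def f_def
    by (intro the_equality) (auto dest: injD[OF inj_gf_emb[OF ch]])
  with c show ?thesis by (simp add: f_def)
qed

definition trace_code :: "nat \<Rightarrow> 'q::finite_field list \<Rightarrow> 'p::prime_card mod_ring vec set" where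
  "trace_code m ds = range (\<lambda>x. vec_of_list (map (\<lambda>d. gf_trace m (x * d)) ds))"

definition linear_code :: "nat \<Rightarrow> nat \<Rightarrow> 'k::field vec set \<Rightarrow> bool" where
  "linear_code n k C \<longleftrightarrow>
     VectorSpace.subspace class_ring C (module_vec TYPE('k) n) \<and>
     vectorspace.dim class_ring (module_vec TYPE('k) n\<lparr>carrier := C\<rparr>) = k"

definition hamming_weight :: "'k::zero vec \<Rightarrow> nat" where
  "hamming_weight v = card {i. i < dim_vec v \<and> v $ i \<noteq> 0}"

definition weight_count :: "'k::zero vec set \<Rightarrow> nat \<Rightarrow> nat" where
  "weight_count C w = card {c \<in> C. hamming_weight c = w}"

end

theory Submission
  imports Defs
begin

text \<open>
  The proof avoids Gauss sums. Put \<open>P = p^(m-1)\<close> and let \<open>c t\<close> be the number of \<open>y\<close> with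
  \<open>Tr (y\<^sup>2) = t\<close>. As \<open>m\<close> is odd, a nonsquare \<open>s\<close> of \<open>GF(p)\<close> remains a nonsquare in \<open>GF(q)\<close>, so
  the maps \<open>y \<mapsto> y\<^sup>2\<close> and \<open>y \<mapsto> s y\<^sup>2\<close> together hit every element exactly twice; hence
  \<open>c (s u) + c u = 2 P\<close>. So \<open>c 0 = P\<close>, and \<open>c t = P \<plusminus> e\<close> for \<open>t \<noteq> 0\<close> with a common \<open>e\<close>, which the
  second moment of \<open>c\<close> shows to satisfy \<open>e\<^sup>2 = P\<close>. Stereographic projection from \<open>x \<noteq> 0\<close> on the
  quadric \<open>{y. Tr (y\<^sup>2) = Tr (x\<^sup>2)}\<close> expresses the number of zeros of \<open>y \<mapsto> Tr (x y)\<close> on the cone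
  \<open>{y. Tr (y\<^sup>2) = 0}\<close>, and thereby the weight of the codeword of \<open>x\<close>, through \<open>c (Tr (x\<^sup>2))\<close>. The
  sign of \<open>c t - P\<close> never has to be determined: since the deviations sum to \<open>0\<close>, both signs occur
  for \<open>(p - 1) / 2\<close> values of \<open>t\<close>.
\<close>

section \<open>Counting lemmas\<close>

lemma sum_card_fibres:
  fixes f :: "'a \<Rightarrow> 'b" and g :: "'b \<Rightarrow> 'c::comm_semiring_1"
  assumes "finite W" "finite {x. f x \<in> W}"
  shows "(\<Sum>x | f x \<in> W. g (f x)) = (\<Sum>w\<in>W. of_nat (card {x. f x = w}) * g w)"
proof -
  have "(\<Sum>x | f x \<in> W. g (f x)) = (\<Sum>w\<in>W. \<Sum>x | x \<in> {x. f x \<in> W} \<and> f x = w. g (f x))"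
    by (rule sum.group[symmetric]) (use assms in auto)
  also have "\<dots> = (\<Sum>w\<in>W. of_nat (card {x. f x = w}) * g w)"
    by (intro sum.cong refl) (simp add: conj_commute cong: conj_cong)
  finally show ?thesis .
qed

lemma card_eq_sum_card_fibres:
  assumes "finite W" "finite {x. f x \<in> W}"
  shows "card {x. f x \<in> W} = (\<Sum>w\<in>W. card {x. f x = w})"
  using sum_card_fibres[OF assms, of "\<lambda>_. 1 :: nat"] by simp

text \<open>Turns upper bounds on fibre sizes into exact sizes once their total is known; used for
  trace fibres and for square roots.\<close>

lemma eq_upper_bound_if_sum_eq:
  fixes f :: "'a \<Rightarrow> nat"
  assumes "finite A" "\<And>x. x \<in> A \<Longrightarrow> f x \<le> k" "sum f A = card A * k" "x \<in> A"
  shows "f x = k"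
proof (rule ccontr)
  assume "f x \<noteq> k"
  with assms have "f x < k" by (simp add: le_neq_implies_less)
  with assms have "sum f A < (\<Sum>_\<in>A. k)" by (intro sum_strict_mono_ex1) auto
  with assms show False by simp
qed

text \<open>Coordinates in a basis identify the space with the functions from the basis to the
  scalars. The dimension of the code can thus be read off from its number of words.\<close>

lemma (in vectorspace) card_eq_power_dim:
  assumes "finite (carrier V)"
  shows "card (carrier V) = card (carrier K) ^ dim"
proof -
  have "carrier V \<subseteq> span (carrier V)" by (rule in_own_span) simp
  then have "fin_dim"
    unfolding fin_dim_def using assms span_is_subset2[of "carrier V"] by blast
  then obtain A where A: "finite A" "basis A" using finite_basis_exists by blast
  then have AV: "A \<subseteq> carrier V" by (simp add: basis_def)
  have ex1: "\<exists>!a. a \<in> A \<rightarrow>\<^sub>E carrier K \<and> lincomb a A = v" if "v \<in> carrier V" for v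
    using basis_criterion[OF A(1) AV] A(2) that by blast
  have closed: "lincomb a A \<in> carrier V" if "a \<in> A \<rightarrow>\<^sub>E carrier K" for a
    by (rule lincomb_closed[OF AV]) (use that in auto)
  have "bij_betw (\<lambda>a. lincomb a A) (A \<rightarrow>\<^sub>E carrier K) (carrier V)"
  proof (rule bij_betw_imageI)
    show "inj_on (\<lambda>a. lincomb a A) (A \<rightarrow>\<^sub>E carrier K)"
      using ex1 closed by (metis (no_types, lifting) inj_onI)
    show "(\<lambda>a. lincomb a A) ` (A \<rightarrow>\<^sub>E carrier K) = carrier V"
      using ex1 closed by blast
  qed
  then have "card (carrier V) = card (A \<rightarrow>\<^sub>E carrier K)"
    by (simp add: bij_betw_same_card)
  then show ?thesis by (simp add: card_funcsetE dim_basis[OF A] A(1))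
qed

section \<open>The embedding of the prime field and the trace\<close>

locale odd_trace =
  fixes m p :: nat and Tr :: "'q::finite_field \<Rightarrow> 'p::prime_card mod_ring"
  defines "Tr \<equiv> gf_trace m"
  assumes card_p [simp]: "CARD('p) = p"
    and card_q: "CARD('q) = p ^ m"
    and odd_p: "odd p" and odd_m: "odd m" and m_gt_1: "m > 1"
begin

abbreviation P :: nat where "P \<equiv> p ^ (m - 1)"
abbreviation emb :: "'p mod_ring \<Rightarrow> 'q" where "emb \<equiv> gf_emb"

lemma prime_p: "prime p"
  using prime_card[where ?'a='p] by simp

lemma m_pos: "m > 0"
  using m_gt_1 by simp

lemma p_gt_2: "p > 2"
  using prime_p odd_p prime_gt_1_nat[of p] by (cases "p = 2") auto

lemma q_eq: "CARD('q) = p * P"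
  using m_pos by (simp add: card_q power_eq_if)

lemma CHAR_q: "CHAR('q) = p"
  using CHAR_eq_of_CARD[where ?'q='q and ?'p='p and m=m] card_q by simp

lemma range_emb: "range emb = {y. y ^ p = y}"
  using range_gf_emb[where ?'q='q and ?'p='p] CHAR_q by simp

lemma emb_eq_iff [simp]: "emb a = emb b \<longleftrightarrow> a = b"
  using inj_gf_emb[where ?'q='q and ?'p='p] CHAR_q by (auto dest: injD)

text \<open>Makes \<open>emb\<close> a ring homomorphism: representatives are added and multiplied
  mod \<open>p\<close>, which characteristic \<open>p\<close> does not see.\<close>

lemma of_int_mod_p: "(of_int (k mod int p) :: 'q) = of_int k"
  by (simp add: of_int_eq_iff_cong_CHAR CHAR_q cong_def)

lemma emb_add: "emb (a + b) = emb a + emb b"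
proof -
  have "to_int_mod_ring (a + b) = (to_int_mod_ring a + to_int_mod_ring b) mod int p"
    by (subst card_p[symmetric], transfer) simp
  then show ?thesis by (simp only: gf_emb_def of_int_mod_p of_int_add)
qed

lemma emb_mult: "emb (a * b) = emb a * emb b"
proof -
  have "to_int_mod_ring (a * b) = (to_int_mod_ring a * to_int_mod_ring b) mod int p"
    by (subst card_p[symmetric], transfer) simp
  then show ?thesis by (simp only: gf_emb_def of_int_mod_p of_int_mult)
qed

lemma emb_0 [simp]: "emb 0 = 0" and emb_1 [simp]: "emb 1 = 1"
  by (simp_all add: gf_emb_def)

lemma emb_eq_0_iff [simp]: "emb a = 0 \<longleftrightarrow> a = 0"
  using emb_eq_iff[of a 0] by simp

lemma emb_power: "emb (a ^ k) = emb a ^ k"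
  by (induction k) (simp_all add: emb_mult)

lemma emb_power_p: "emb a ^ p = emb a"
  using range_emb by blast

lemma emb_power_p_power: "emb a ^ (p ^ i) = emb a"
  by (induction i) (simp_all add: power_mult emb_power_p)

lemma emb_Tr: "emb (Tr x) = (\<Sum>i<m. x ^ (p ^ i))"
  using gf_emb_gf_trace[where ?'p='p and m=m and x=x] card_q by (simp add: Tr_def)

lemma Tr_add: "Tr (x + y) = Tr x + Tr y"
proof -
  have "(x + y) ^ (p ^ i) = x ^ (p ^ i) + y ^ (p ^ i)" for i
    by (rule freshmans_dream') (simp_all add: CHAR_q prime_p)
  then have "emb (Tr (x + y)) = emb (Tr x + Tr y)"
    by (simp add: emb_Tr emb_add sum.distrib)
  then show ?thesis by simp
qed

lemma Tr_scale: "Tr (emb a * x) = a * Tr x"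
proof -
  have "emb (Tr (emb a * x)) = emb (a * Tr x)"
    by (simp add: emb_Tr emb_mult power_mult_distrib emb_power_p_power sum_distrib_left)
  then show ?thesis by simp
qed

lemma Tr_scale_sq: "Tr ((emb a * x) ^ 2) = a ^ 2 * Tr (x ^ 2)"
  by (simp add: power_mult_distrib Tr_scale flip: emb_power)

lemma emb_cancel:
  assumes "a \<noteq> 0"
  shows "emb (1 / a) * (emb a * x) = x" "emb a * (emb (1 / a) * x) = x"
  using assms by (simp_all flip: mult.assoc emb_mult)

lemma Tr_0 [simp]: "Tr 0 = 0"
  using Tr_scale[of 0 0] by simp

lemma Tr_diff: "Tr (x - y) = Tr x - Tr y"
  using Tr_add[of "x - y" y] by (simp add: algebra_simps)

text \<open>A fibre is the root set of a polynomial of degree at most \<open>P\<close>, and the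
  \<open>p\<close> fibres have to cover \<open>p * P\<close> elements.\<close>

lemma card_Tr_fibre: "card {x. Tr x = t} = P"
proof -
  have bound: "card {x. Tr x = c} \<le> P" for c
  proof -
    define f :: "'q poly" where "f = (\<Sum>i<m. monom 1 (p ^ i)) - [:emb c:]"
    have p1: "p > 1" using p_gt_2 by simp
    \<comment> \<open>Only \<open>i = m - 1\<close> reaches the exponent \<open>P\<close>, and the
      constant term sits at \<open>0 < P\<close>; so \<open>f\<close> is nonzero.\<close>
    have "coeff f P = (\<Sum>i<m. if p ^ i = P then 1 else 0)"
      using p1 by (simp add: f_def coeff_sum coeff_pCons split: nat.split)
    also have "\<dots> = (\<Sum>i<m. if i = m - 1 then 1 else 0)"
      using p1 by (intro sum.cong) (auto simp: power_inject_exp)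
    also have "\<dots> = 1" using m_pos by simp
    finally have nz: "f \<noteq> 0" by auto
    have "degree f \<le> P"
      unfolding f_def
      using p1 by (intro degree_diff_le degree_sum_le)
        (auto intro!: order.trans[OF degree_monom_le] power_increasing)
    moreover have "{x. Tr x = c} = {x. poly f x = 0}"
      by (auto simp: f_def poly_sum poly_monom emb_Tr[symmetric])
    ultimately show ?thesis using card_poly_roots_bound[OF nz] by simp
  qed
  have "(\<Sum>c\<in>UNIV. card {x. Tr x = c}) = CARD('p mod_ring) * P"
    using card_eq_sum_card_fibres[of UNIV Tr] by (simp add: q_eq)
  then show ?thesis
    using bound eq_upper_bound_if_sum_eq[of UNIV "\<lambda>c. card {x. Tr x = c}" P t] by simp
qed

lemma card_Tr_mult_fibre:
  assumes "x \<noteq> 0"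
  shows "card {y. Tr (x * y) = t} = P"
proof -
  have "bij_betw ((*) x) {y. Tr (x * y) = t} {z. Tr z = t}"
    by (rule bij_betw_byWitness[where f' = "\<lambda>z. z / x"]) (use assms in auto)
  then show ?thesis by (simp add: bij_betw_same_card card_Tr_fibre)
qed

section \<open>Squares and the quadratic form\<close>

lemma two_neq_0: "(2 :: 'q) \<noteq> 0" "(2 :: 'p mod_ring) \<noteq> 0"
proof -
  have "\<not> p dvd 2" using p_gt_2 by (auto dest: dvd_imp_le)
  then have "(of_nat 2 :: 'q) \<noteq> 0" unfolding of_nat_eq_0_iff_char_dvd by (simp add: CHAR_q)
  then show "(2 :: 'q) \<noteq> 0" by simp
  then have "emb (1 + 1) \<noteq> 0" by (simp only: emb_add emb_1) simp
  then show "(2 :: 'p mod_ring) \<noteq> 0" by (simp add: one_add_one)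
qed

text \<open>\<open>1\<close> and \<open>-1\<close> have the same square, so squaring is not
  injective and, on a finite set, not surjective.\<close>

lemma ex_nonsquare: "\<exists>s :: 'p mod_ring. \<forall>a. s \<noteq> a ^ 2"
proof (rule ccontr)
  assume "\<not> ?thesis"
  then have "surj (\<lambda>a :: 'p mod_ring. a ^ 2)" by (metis surj_def)
  then have "inj (\<lambda>a :: 'p mod_ring. a ^ 2)"
    by (rule finite_UNIV_surj_inj[OF finite])
  then have "(1 :: 'p mod_ring) = - 1" by (rule injD) simp
  then have "(2 :: 'p mod_ring) = 0" by (metis add.right_inverse one_add_one)
  with two_neq_0 show False by simp
qed

text \<open>If \<open>y\<close> is a square root of \<open>s\<close>, the Frobenius map sends \<open>y\<close> to \<open>y\<close> or \<open>-y\<close>. In the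
  second case its \<open>m\<close>-th power, which is the identity, would send \<open>y\<close> to \<open>-y\<close> as \<open>m\<close> is odd.\<close>

lemma emb_nonsquare:
  assumes "\<And>a. s \<noteq> a ^ 2"
  shows "emb s \<noteq> y ^ 2"
proof
  assume y: "emb s = y ^ 2"
  have "(y ^ p) ^ 2 = y ^ 2"
    using emb_power_p[of s] by (simp add: y flip: power_mult add: mult.commute)
  then consider "y ^ p = y" | "y ^ p = - y" by (auto simp: power2_eq_iff)
  then show False
  proof cases
    case 1
    then obtain a where "y = emb a" using range_emb by blast
    with y have "emb s = emb (a ^ 2)" by (simp add: emb_power)
    with assms show False by simp
  next
    case 2
    have "y ^ (p ^ i) = (- 1) ^ i * y" for i
      by (induction i) (simp_all add: power_mult power_mult_distrib 2 odd_p uminus_power_if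
          mult.commute[of p])
    from this[of m] have "y = - y"
      using finite_field_power_card_eq_same[of y] by (simp add: card_q odd_m)
    then have "2 * y = 0" by (metis add.right_inverse mult_2)
    with two_neq_0 have "y = 0" by simp
    with y have "s = 0" by simp
    with assms[of 0] show False by simp
  qed
qed

text \<open>A nonzero \<open>w\<close> is not both a square and \<open>\<sigma>\<close> times a
  square, and has at most two roots of either kind; \<open>0\<close> has one of each. So the sum is
  at most \<open>2\<close>, while its total over all \<open>w\<close> is
  \<open>2 * CARD('q)\<close>.\<close>

lemma card_sqrt_add_card_sqrt_twisted:
  fixes \<sigma> w :: 'q
  assumes "\<And>y. \<sigma> \<noteq> y ^ 2"
  shows "card {y. y ^ 2 = w} + card {y. \<sigma> * y ^ 2 = w} = 2"
proof -
  let ?f = "\<lambda>w. card {y. y ^ 2 = w} + card {y. \<sigma> * y ^ 2 = w}"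
  have s0: "\<sigma> \<noteq> 0" using assms[of 0] by simp
  have pm: "card {y, - y} \<le> 2" for y :: 'q by (simp add: card_insert_if)
  have "?f w \<le> 2" for w
  proof (cases "w = 0")
    case True
    then show ?thesis using s0 by simp
  next
    case w: False
    show ?thesis
    proof (cases "\<exists>y. y ^ 2 = w")
      case True
      then obtain y where y: "y ^ 2 = w" by blast
      have "\<sigma> * z ^ 2 \<noteq> w" for z
      proof
        assume z: "\<sigma> * z ^ 2 = w"
        with w have "z \<noteq> 0" by auto
        with y z have "\<sigma> = (y / z) ^ 2" by (simp add: power_divide field_simps)
        with assms show False by blast
      qed
      moreover have "{z. z ^ 2 = w} = {y, - y}" using y by (auto simp: power2_eq_iff)
      ultimately show ?thesis using pm[of y] by simp
    next
      case no: False
      show ?thesis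
      proof (cases "\<exists>y. \<sigma> * y ^ 2 = w")
        case True
        then obtain y where y: "\<sigma> * y ^ 2 = w" by blast
        have "{z. \<sigma> * z ^ 2 = w} = {y, - y}" using y s0 by (auto simp: power2_eq_iff)
        then show ?thesis using no pm[of y] by simp
      qed (use no in simp)
    qed
  qed
  moreover have "(\<Sum>w\<in>UNIV. ?f w) = CARD('q) * 2"
    using card_eq_sum_card_fibres[of UNIV "\<lambda>y::'q. y ^ 2"]
      card_eq_sum_card_fibres[of UNIV "\<lambda>y::'q. \<sigma> * y ^ 2"]
    by (simp add: sum.distrib)
  ultimately show ?thesis using eq_upper_bound_if_sum_eq[of UNIV ?f 2 w] by simp
qed

section \<open>Distribution of the values of \<open>Tr (y ^ 2)\<close>\<close>

definition cnt :: "'p mod_ring \<Rightarrow> nat" where "cnt t = card {y. Tr (y ^ 2) = t}"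
text \<open>\<open>P\<close> is the mean of \<open>cnt\<close>; the difference is an integer because
  both signs occur.\<close>

definition dev :: "'p mod_ring \<Rightarrow> int" where "dev t = int (cnt t) - int P"

text \<open>Sums the two-fold covering by squares and twisted squares over a trace fibre; the factor
  \<open>emb s\<close> leaves the trace as \<open>s\<close>.\<close>

lemma cnt_add_cnt_twisted:
  assumes "\<And>a. s \<noteq> a ^ 2"
  shows "cnt t + card {y. s * Tr (y ^ 2) = t} = 2 * P"
proof -
  have "cnt t = (\<Sum>w | Tr w = t. card {y. y ^ 2 = w})"
    using card_eq_sum_card_fibres[of "{w. Tr w = t}" "\<lambda>y. y ^ 2"] by (simp add: cnt_def)
  moreover have "card {y. s * Tr (y ^ 2) = t} = (\<Sum>w | Tr w = t. card {y. emb s * y ^ 2 = w})"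
    using card_eq_sum_card_fibres[of "{w. Tr w = t}" "\<lambda>y. emb s * y ^ 2"] by (simp add: Tr_scale)
  ultimately have "cnt t + card {y. s * Tr (y ^ 2) = t}
      = (\<Sum>w | Tr w = t. card {y. y ^ 2 = w} + card {y. emb s * y ^ 2 = w})"
    by (simp add: sum.distrib)
  also have "\<dots> = (\<Sum>w | Tr w = t. 2)"
    by (intro sum.cong refl card_sqrt_add_card_sqrt_twisted emb_nonsquare assms)
  also have "\<dots> = 2 * P" by (simp add: card_Tr_fibre)
  finally show ?thesis .
qed

lemma dev_nonsquare_mult:
  assumes "\<And>a. s \<noteq> a ^ 2"
  shows "dev (s * u) = - dev u"
proof -
  have "s \<noteq> 0" using assms[of 0] by simp
  then have "card {y. s * Tr (y ^ 2) = s * u} = cnt u" by (simp add: cnt_def)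
  then have "int (cnt (s * u) + cnt u) = int (2 * P)"
    using cnt_add_cnt_twisted[OF assms, of "s * u"] by metis
  then show ?thesis by (simp add: dev_def)
qed

text \<open>Multiplication by a nonsquare fixes \<open>0\<close> but negates
  \<open>dev\<close>.\<close>

lemma dev_0 [simp]: "dev 0 = 0"
  using ex_nonsquare dev_nonsquare_mult[of _ 0] by fastforce

lemma cnt_0: "cnt 0 = P"
  using dev_0 by (simp add: dev_def)

text \<open>Scaling \<open>y\<close> by \<open>emb a\<close> multiplies \<open>Tr (y ^ 2)\<close> by
  \<open>a ^ 2\<close>.\<close>

lemma dev_square_mult:
  assumes "a \<noteq> 0"
  shows "dev (a ^ 2 * u) = dev u"
proof -
  have "bij_betw ((*) (emb a)) {y. Tr (y ^ 2) = u} {y. Tr (y ^ 2) = a ^ 2 * u}"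
  proof (rule bij_betw_byWitness[where f' = "(*) (emb (1 / a))"])
    have "Tr ((emb (1 / a) * z) ^ 2) = u" if "Tr (z ^ 2) = a ^ 2 * u" for z
      using that assms by (simp add: Tr_scale_sq power_divide)
    then show "(*) (emb (1 / a)) ` {y. Tr (y ^ 2) = a ^ 2 * u} \<subseteq> {y. Tr (y ^ 2) = u}"
      by blast
  qed (simp_all add: emb_cancel[OF assms] Tr_scale_sq image_subset_iff)
  then have "cnt u = cnt (a ^ 2 * u)" unfolding cnt_def by (rule bij_betw_same_card)
  then show ?thesis by (simp add: dev_def)
qed

lemma dev_sq_eq_dev_1_sq:
  assumes "t \<noteq> 0"
  shows "dev t ^ 2 = dev 1 ^ 2"
proof (cases "\<exists>a. t = a ^ 2")
  case True
  then obtain a where a: "t = a ^ 2" by blast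
  with assms have "a \<noteq> 0" by auto
  then have "dev t = dev 1" using dev_square_mult[of a 1] a by simp
  then show ?thesis by simp
next
  case False
  with dev_nonsquare_mult[of t 1] show ?thesis by simp
qed

lemma sum_cnt: "(\<Sum>t\<in>UNIV. cnt t) = p * P"
  using card_eq_sum_card_fibres[of UNIV "\<lambda>y. Tr (y ^ 2)"] by (simp add: cnt_def q_eq)

lemma sum_dev: "(\<Sum>t\<in>UNIV. dev t) = 0"
  using sum_cnt by (simp add: dev_def sum_subtractf flip: of_nat_sum)

text \<open>The substitution \<open>u = x - y\<close>, \<open>v = x + y\<close> turns \<open>Tr (x\<^sup>2) = Tr (y\<^sup>2)\<close> into the bilinear
  condition \<open>Tr (u v) = 0\<close>.\<close>

lemma sum_cnt_sq: "(\<Sum>t\<in>UNIV. cnt t ^ 2) + P = p * P + p * P * P"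
proof -
  let ?A = "SIGMA x:UNIV. {y. Tr (y ^ 2) = Tr (x ^ 2)}"
  let ?B = "SIGMA u:UNIV. {v. Tr (u * v) = 0}"
  have "bij_betw (\<lambda>(x, y). (x - y, x + y)) ?A ?B"
  proof (rule bij_betw_byWitness[where f' = "\<lambda>(u, v). ((u + v) / 2, (v - u) / 2)"])
    have double: "x - y + (x + y) = 2 * x" "x + y - (x - y) = 2 * y"
      "x + y - (y - x) = 2 * x" "x + y + (y - x) = 2 * y" for x y :: 'q
      by simp_all
    have half: "(x - y + (x + y)) / 2 = x" "(x + y - (x - y)) / 2 = y"
      "(x + y) / 2 - (y - x) / 2 = x" "(x + y) / 2 + (y - x) / 2 = y" for x y :: 'q
      unfolding diff_divide_distrib[symmetric] add_divide_distrib[symmetric] double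
      using two_neq_0 by simp_all
    have diff_sq: "(x - y) * (x + y) = x ^ 2 - y ^ 2" for x y :: 'q
      by (simp add: algebra_simps power2_eq_square)
    show "\<forall>a\<in>?A. (\<lambda>(u, v). ((u + v) / 2, (v - u) / 2)) ((\<lambda>(x, y). (x - y, x + y)) a) = a"
      using two_neq_0 by (simp add: half split: prod.split)
    show "\<forall>a\<in>?B. (\<lambda>(x, y). (x - y, x + y)) ((\<lambda>(u, v). ((u + v) / 2, (v - u) / 2)) a) = a"
      by (simp add: half split: prod.split)
    show "(\<lambda>(x, y). (x - y, x + y)) ` ?A \<subseteq> ?B"
      by (auto simp: diff_sq Tr_diff)
    have "Tr (((v - u) / 2) ^ 2) = Tr (((u + v) / 2) ^ 2)" if "Tr (u * v) = 0" for u v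
    proof -
      from that have "Tr (((u + v) / 2) ^ 2 - ((v - u) / 2) ^ 2) = 0"
        by (simp only: diff_sq[symmetric] half)
      then show ?thesis by (simp add: Tr_diff)
    qed
    then show "(\<lambda>(u, v). ((u + v) / 2, (v - u) / 2)) ` ?B \<subseteq> ?A" by auto
  qed
  then have AB: "card ?A = card ?B" by (rule bij_betw_same_card)
  \<comment> \<open>Pairs on which the form takes equal values are counted by the second moment of
    \<open>cnt\<close>.\<close>
  have "card ?A = (\<Sum>x\<in>UNIV. cnt (Tr (x ^ 2)))" by (simp add: cnt_def)
  also have "\<dots> = (\<Sum>t\<in>UNIV. cnt t * cnt t)"
    using sum_card_fibres[of UNIV "\<lambda>x. Tr (x ^ 2)" cnt] by (simp flip: cnt_def)
  also have "\<dots> = (\<Sum>t\<in>UNIV. cnt t ^ 2)" by (simp only: power2_eq_square)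
  finally have A: "card ?A = (\<Sum>t\<in>UNIV. cnt t ^ 2)" .
  \<comment> \<open>\<open>u = 0\<close> admits every \<open>v\<close>; any other \<open>u\<close>
    leaves a hyperplane of \<open>P\<close> elements.\<close>
  have "card ?B = (\<Sum>u\<in>UNIV. card {v. Tr (u * v) = 0})" by simp
  also have "\<dots> = CARD('q) + (\<Sum>u\<in>UNIV - {0}. card {v. Tr (u * v) = 0})"
    by (simp add: sum.remove[of UNIV 0])
  also have "\<dots> = p * P + (p * P - 1) * P"
    by (simp add: card_Tr_mult_fibre card_Diff_singleton q_eq)
  finally have "card ?B = p * P + (p * P - 1) * P" .
  moreover have "(p * P - 1) * P + P = p * P * P"
    using p_gt_2 by (cases "p * P") auto
  ultimately show ?thesis using A AB by simp
qed

text \<open>With \<open>cnt t = P + dev t\<close> in \<open>sum_cnt_sq\<close>, the linear term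
  cancels by \<open>sum_dev\<close>, and the \<open>p - 1\<close> nonzero \<open>t\<close>
  contribute equally.\<close>

lemma dev_sq:
  assumes "t \<noteq> 0"
  shows "dev t ^ 2 = int P"
proof -
  have "(\<Sum>t\<in>UNIV. int (cnt t) ^ 2) = (\<Sum>t\<in>UNIV. int P ^ 2 + 2 * int P * dev t + dev t ^ 2)"
    by (intro sum.cong refl) (simp add: dev_def power2_eq_square algebra_simps)
  also have "\<dots> = int p * int P ^ 2 + (\<Sum>t\<in>UNIV. dev t ^ 2)"
    by (simp add: sum.distrib sum_dev flip: sum_distrib_left)
  also have "(\<Sum>t\<in>UNIV. dev t ^ 2) = (\<Sum>t\<in>UNIV - {0}. dev t ^ 2)"
    by (simp add: sum.remove[of UNIV 0])
  also have "\<dots> = (\<Sum>t::'p mod_ring\<in>UNIV - {0}. dev 1 ^ 2)"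
    by (intro sum.cong refl dev_sq_eq_dev_1_sq) simp
  also have "\<dots> = (int p - 1) * dev 1 ^ 2"
    using p_gt_2 by (simp add: card_Diff_singleton of_nat_diff)
  finally have "(\<Sum>t\<in>UNIV. int (cnt t) ^ 2) = int p * int P ^ 2 + (int p - 1) * dev 1 ^ 2" .
  moreover have "(\<Sum>t\<in>UNIV. int (cnt t) ^ 2) + int P = int p * int P + int p * int P * int P"
    using arg_cong[OF sum_cnt_sq, of int] by simp
  ultimately have "(int p - 1) * dev 1 ^ 2 = (int p - 1) * int P"
    by (simp add: algebra_simps power2_eq_square)
  then have "dev 1 ^ 2 = int P" using p_gt_2 by simp
  with dev_sq_eq_dev_1_sq[OF assms] show ?thesis by simp
qed

text \<open>The absolute value of \<open>dev\<close> away from \<open>0\<close>: the square root of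
  \<open>P\<close>, exact because \<open>m - 1\<close> is even.\<close>

definition r :: nat where "r = p ^ ((m - 1) div 2)"

lemma r_pos: "r > 0" and r_sq: "r ^ 2 = P"
proof -
  show "r > 0" using p_gt_2 by (simp add: r_def)
  have "(m - 1) div 2 * 2 = m - 1" using odd_m by simp
  then show "r ^ 2 = P" by (simp only: r_def power_mult[symmetric])
qed

lemma dev_cases:
  assumes "t \<noteq> 0"
  shows "dev t = int r \<or> dev t = - int r"
proof -
  have "dev t ^ 2 = int r ^ 2" by (simp only: dev_sq[OF assms] r_sq[symmetric] of_nat_power)
  then show ?thesis by (simp only: power2_eq_iff)
qed

text \<open>Since the deviations sum to \<open>0\<close>, \<open>r\<close> and \<open>-r\<close> are
  equally frequent among the \<open>p - 1\<close> nonzero \<open>t\<close>.\<close>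

lemma card_dev_eq:
  assumes "e = int r \<or> e = - int r"
  shows "2 * card {t. dev t = e} = p - 1"
proof -
  let ?A = "{t. dev t = int r}" and ?B = "{t. dev t = - int r}"
  have AB: "?A \<union> ?B = UNIV - {0}" "?A \<inter> ?B = {}"
    using dev_cases r_pos by auto
  have "0 = (\<Sum>t\<in>UNIV - {0}. dev t)"
    using sum_dev by (simp add: sum.remove[of UNIV 0])
  also have "\<dots> = (\<Sum>t\<in>?A. dev t) + (\<Sum>t\<in>?B. dev t)"
    using sum.union_disjoint[of ?A ?B dev] AB by simp
  also have "\<dots> = int r * (int (card ?A) - int (card ?B))" by (simp add: algebra_simps)
  finally have "card ?A = card ?B" using r_pos by simp
  moreover have "card ?A + card ?B = p - 1"
    using card_Un_disjoint[of ?A ?B] AB by (simp add: card_Diff_singleton)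
  ultimately show ?thesis using assms by auto
qed

lemma card_dev_Tr_eq:
  assumes "e = int r \<or> e = - int r"
  shows "2 * int (card {x. dev (Tr (x ^ 2)) = e}) = int (p - 1) * (int P + e)"
proof -
  have "card {x. dev (Tr (x ^ 2)) = e} = (\<Sum>t | dev t = e. cnt t)"
    using card_eq_sum_card_fibres[of "{t. dev t = e}" "\<lambda>x. Tr (x ^ 2)"] by (simp add: cnt_def)
  then have "int (card {x. dev (Tr (x ^ 2)) = e}) = (\<Sum>t | dev t = e. int (cnt t))" by simp
  also have "\<dots> = (\<Sum>t | dev t = e. int P + e)"
    by (intro sum.cong refl) (auto simp: dev_def)
  also have "\<dots> = int (card {t. dev t = e}) * (int P + e)" by simp
  finally show ?thesis
    using arg_cong[OF card_dev_eq[OF assms], of int] by simp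
qed

section \<open>Weights\<close>

definition nul :: "'q \<Rightarrow> nat" where
  "nul x = card {y. Tr (y ^ 2) = 0 \<and> Tr (x * y) = 0}"

text \<open>The Hamming weight of the codeword of \<open>x\<close>, free of the enumeration of the
  cone; the extra point \<open>y = 0\<close> adds nothing.\<close>

definition wt :: "'q \<Rightarrow> nat" where
  "wt x = card {y. Tr (y ^ 2) = 0 \<and> Tr (x * y) \<noteq> 0}"

text \<open>Stereographic projection from \<open>x\<close>: a point \<open>x + w\<close> with \<open>Tr (w\<^sup>2) \<noteq> 0\<close> of the quadric through
  \<open>x\<close> is determined by its direction \<open>w\<close>, and the directions that occur are the lines spanned
  by the \<open>v\<close> with \<open>Tr (v\<^sup>2) \<noteq> 0\<close> and \<open>Tr (x v) \<noteq> 0\<close>.\<close>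

lemma cnt_Tr_sq:
  assumes "x \<noteq> 0"
  shows "(p - 1) * cnt (Tr (x ^ 2)) + 2 * P = p * nul x + p * P"
proof -
  \<comment> \<open>\<open>W\<close> holds the displacements from \<open>x\<close> that stay on the
    quadric, split into \<open>W0\<close> on the cone and \<open>W1\<close> off it.\<close>
  define W where "W = {w. Tr (w ^ 2) + 2 * Tr (x * w) = 0}"
  define W0 where "W0 = {y. Tr (y ^ 2) = 0 \<and> Tr (x * y) = 0}"
  define W1 where "W1 = {w. Tr (w ^ 2) \<noteq> 0 \<and> Tr (w ^ 2) + 2 * Tr (x * w) = 0}"
  define V1 where "V1 = {v. Tr (v ^ 2) \<noteq> 0 \<and> Tr (x * v) \<noteq> 0}"
  have Tr2: "Tr (2 * z) = 2 * Tr z" for z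
    by (simp only: mult_2 Tr_add)
  have Q_add: "Tr ((x + w) ^ 2) = Tr (x ^ 2) + (Tr (w ^ 2) + 2 * Tr (x * w))" for w
    by (simp add: power2_sum Tr_add Tr2 mult.assoc)
  have "bij_betw ((+) x) W {y. Tr (y ^ 2) = Tr (x ^ 2)}"
  proof (rule bij_betw_byWitness[where f' = "\<lambda>y. y - x"])
    show "(\<lambda>y. y - x) ` {y. Tr (y ^ 2) = Tr (x ^ 2)} \<subseteq> W"
    proof clarify
      fix y assume "Tr (y ^ 2) = Tr (x ^ 2)"
      with Q_add[of "y - x"] show "y - x \<in> W" by (simp add: W_def)
    qed
  qed (auto simp: W_def Q_add)
  then have "card W = cnt (Tr (x ^ 2))"
    unfolding cnt_def by (rule bij_betw_same_card)
  moreover have "W = W0 \<union> W1" "W0 \<inter> W1 = {}"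
    using two_neq_0 by (auto simp: W_def W0_def W1_def)
  moreover have "card W0 = nul x" by (simp add: W0_def nul_def)
  ultimately have cntW: "cnt (Tr (x ^ 2)) = nul x + card W1"
    using card_Un_disjoint[of W0 W1] by simp
  \<comment> \<open>For \<open>v\<close> in \<open>V1\<close>, the only nonzero multiple of
    \<open>v\<close> in \<open>W\<close> has the factor
    \<open>- 2 * Tr (x * v) / Tr (v ^ 2)\<close>; \<open>c v\<close> is its inverse and so leads
    back to \<open>v\<close>.\<close>
  define c where "c v = - Tr (v ^ 2) / (2 * Tr (x * v))" for v
  have B_scale: "Tr (x * (emb a * v)) = a * Tr (x * v)" for a v
    using Tr_scale[of a "x * v"] by (simp add: ac_simps)
  have c_scale: "c (emb a * w) = a" if "w \<in> W1" "a \<noteq> 0" for a w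
  proof -
    from that have "Tr (w ^ 2) = - 2 * Tr (x * w)" "Tr (x * w) \<noteq> 0"
      by (auto simp: W1_def eq_neg_iff_add_eq_0)
    then have "c (emb a * w) = - (a ^ 2 * (- 2 * Tr (x * w))) / (2 * (a * Tr (x * w)))"
      by (simp only: c_def Tr_scale_sq B_scale)
    with that \<open>Tr (x * w) \<noteq> 0\<close> show ?thesis
      using two_neq_0 by (simp add: power2_eq_square)
  qed
  have c_nz: "c v \<noteq> 0" if "v \<in> V1" for v
    using that two_neq_0 by (simp add: V1_def c_def)
  have "bij_betw (\<lambda>(w, a). emb a * w) (W1 \<times> (UNIV - {0})) V1"
  proof (rule bij_betw_byWitness[where f' = "\<lambda>v. (emb (1 / c v) * v, c v)"])
    show "\<forall>z\<in>W1 \<times> (UNIV - {0}). (\<lambda>v. (emb (1 / c v) * v, c v)) ((\<lambda>(w, a). emb a * w) z) = z"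
      by (auto simp: c_scale emb_cancel)
    show "\<forall>v\<in>V1. (\<lambda>(w, a). emb a * w) (emb (1 / c v) * v, c v) = v"
      by (simp add: emb_cancel c_nz del: mult_eq_0_iff)
    show "(\<lambda>(w, a). emb a * w) ` (W1 \<times> (UNIV - {0})) \<subseteq> V1"
      by (auto simp: W1_def V1_def Tr_scale_sq B_scale)
    show "(\<lambda>v. (emb (1 / c v) * v, c v)) ` V1 \<subseteq> W1 \<times> (UNIV - {0})"
    proof (rule image_subsetI)
      fix v assume v: "v \<in> V1"
      then have c0: "c v \<noteq> 0" by (rule c_nz)
      have "Tr (v ^ 2) = - (2 * c v * Tr (x * v))"
        using v two_neq_0 by (simp add: V1_def c_def)
      then have "(1 / c v) ^ 2 * Tr (v ^ 2) + 2 * ((1 / c v) * Tr (x * v)) = 0"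
        using c0 by (simp add: power2_eq_square)
      with v c0 show "(emb (1 / c v) * v, c v) \<in> W1 \<times> (UNIV - {0})"
        by (simp add: W1_def V1_def Tr_scale_sq B_scale)
    qed
  qed
  then have V1: "card V1 = card W1 * (p - 1)"
    by (auto dest!: bij_betw_same_card simp: card_cartesian_product card_Diff_singleton)
  \<comment> \<open>\<open>V1\<close> is the complement of the cone and the hyperplane orthogonal to
    \<open>x\<close>, each of size \<open>P\<close>, so inclusion-exclusion gives its size.\<close>
  let ?X = "{y. Tr (y ^ 2) = 0}" and ?Y = "{y. Tr (x * y) = 0}"
  have "card (V1 \<union> (?X \<union> ?Y)) = card V1 + card (?X \<union> ?Y)"
    by (rule card_Un_disjoint) (auto simp: V1_def)
  moreover have "V1 \<union> (?X \<union> ?Y) = UNIV" by (auto simp: V1_def)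
  ultimately have "card V1 + card (?X \<union> ?Y) = p * P" by (simp add: q_eq)
  moreover have "card ?X + card ?Y = card (?X \<union> ?Y) + card (?X \<inter> ?Y)"
    by (rule card_Un_Int) simp_all
  moreover have "?X \<inter> ?Y = {y. Tr (y ^ 2) = 0 \<and> Tr (x * y) = 0}" by blast
  ultimately have "card V1 + 2 * P = p * P + nul x"
    using cnt_0 card_Tr_mult_fibre[OF assms, of 0] by (simp add: cnt_def nul_def)
  moreover have "p * nul x = (p - 1) * nul x + nul x"
    using p_gt_2 by (simp add: diff_mult_distrib)
  ultimately show ?thesis using cntW V1 by (simp add: algebra_simps)
qed

text \<open>The cone has \<open>P\<close> points, so \<open>nul x = P - wt x\<close> in
  \<open>cnt_Tr_sq\<close>. The factor \<open>p\<close> avoids a division.\<close>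

lemma wt_eq:
  assumes "x \<noteq> 0"
  shows "int p * int (wt x) = (int p - 1) * (int P - dev (Tr (x ^ 2)))"
proof -
  have "{y. Tr (y ^ 2) = 0} = {y. Tr (y ^ 2) = 0 \<and> Tr (x * y) = 0} \<union> {y. Tr (y ^ 2) = 0 \<and> Tr (x * y) \<noteq> 0}"
    by blast
  then have "P = nul x + wt x"
    unfolding cnt_0[symmetric] cnt_def nul_def wt_def by (simp add: card_Un_disjoint disjoint_iff)
  then have "int P = int (nul x) + int (wt x)" by simp
  moreover have "(int p - 1) * int (cnt (Tr (x ^ 2))) + 2 * int P = int p * int (nul x) + int p * int P"
    using arg_cong[OF cnt_Tr_sq[OF assms], of int] p_gt_2 by (simp add: of_nat_diff)
  ultimately show ?thesis by (simp add: dev_def algebra_simps)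
qed

lemma wt_0 [simp]: "wt 0 = 0"
  by (simp add: wt_def)

section \<open>Possible weights and their frequencies\<close>

text \<open>An odd \<open>m > 1\<close> is at least \<open>3\<close>, so the subtractions in the
  exponents do not truncate.\<close>

lemma P_eq: "P = p * p ^ (m - 2)" and r_eq: "r = p * p ^ ((m - 3) div 2)"
proof -
  obtain k where "m = 2 * k + 1" using odd_m by (rule oddE)
  with m_gt_1 obtain j where "m = 2 * j + 3" by (cases k) auto
  then have "m - 1 = Suc (m - 2)" "(m - 1) div 2 = Suc ((m - 3) div 2)" by simp_all
  then show "P = p * p ^ (m - 2)" "r = p * p ^ ((m - 3) div 2)"
    by (simp_all only: r_def power_Suc)
qed

lemma r_less_P: "r < P"
proof -
  have "p \<le> r" by (subst r_eq) (use p_gt_2 in simp)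
  then have "1 * r < r * r" using r_pos p_gt_2 by (intro mult_strict_right_mono) auto
  then show ?thesis by (simp only: r_sq[symmetric] power2_eq_square mult_1)
qed

lemma r_bounds: "0 < int r" "int r < int P"
  using r_pos r_less_P by (simp_all only: of_nat_less_iff of_nat_0_less_iff)

lemma dev_eq_0_iff: "dev t = 0 \<longleftrightarrow> t = 0"
  using dev_cases[of t] r_pos by (cases "t = 0") auto

lemma wt_eq_iff:
  assumes "x \<noteq> 0" "int p * int w = (int p - 1) * (int P - e)"
  shows "wt x = w \<longleftrightarrow> dev (Tr (x ^ 2)) = e"
proof -
  have "wt x = w \<longleftrightarrow> int p * int (wt x) = int p * int w" using p_gt_2 by simp
  also have "\<dots> \<longleftrightarrow> dev (Tr (x ^ 2)) = e"
    unfolding wt_eq[OF assms(1)] assms(2) using p_gt_2 by auto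
  finally show ?thesis .
qed

text \<open>Weight \<open>0\<close> at a nonzero \<open>x\<close> would force the deviation
  \<open>P\<close>, but deviations are at most \<open>r < P\<close>.\<close>

lemma wt_eq_0_iff: "wt x = 0 \<longleftrightarrow> x = 0"
proof
  assume "wt x = 0"
  show "x = 0"
  proof (rule ccontr)
    assume "x \<noteq> 0"
    from wt_eq[OF this] \<open>wt x = 0\<close> p_gt_2 have dev: "dev (Tr (x ^ 2)) = int P" by simp
    show False
    proof (cases "Tr (x ^ 2) = 0")
      case True
      then have "dev (Tr (x ^ 2)) = 0" by simp
      with dev r_bounds show False by linarith
    next
      case False
      from dev_cases[OF this] dev r_bounds show False by linarith
    qed
  qed
qed simp

lemma card_wt_eq:
  assumes "e = int r \<or> e = - int r" "int p * int w = (int p - 1) * (int P - e)"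
  shows "2 * int (card {x. wt x = w}) = int (p - 1) * (int P + e)"
proof -
  have "(wt x = w) = (dev (Tr (x ^ 2)) = e)" for x
  proof (cases "x = 0")
    case True
    \<comment> \<open>At \<open>x = 0\<close> both sides fail: \<open>w\<close> is nonzero, and
      \<open>dev 0 = 0\<close> differs from \<open>e\<close>.\<close>
    have "int P - e \<noteq> 0" using assms(1) r_bounds by linarith
    then have "int p * int w \<noteq> 0" unfolding assms(2) using p_gt_2 by simp
    then show ?thesis using True assms(1) r_pos by auto
  qed (rule wt_eq_iff[OF _ assms(2)])
  then show ?thesis using card_dev_Tr_eq[OF assms(1)] by simp
qed

text \<open>This weight belongs to deviation \<open>0\<close>, that is, to the cone without its
  point \<open>0\<close>.\<close>

lemma card_wt_eq_middle:
  assumes "int p * int w = (int p - 1) * int P"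
  shows "card {x. wt x = w} = P - 1"
proof -
  have "int p * int w \<noteq> 0" unfolding assms using p_gt_2 by simp
  then have "w \<noteq> 0" by auto
  have "(wt x = w) = (x \<in> {x. Tr (x ^ 2) = 0} - {0})" for x
  proof (cases "x = 0")
    case False
    with wt_eq_iff[of x w 0] assms show ?thesis by (simp add: dev_eq_0_iff)
  qed (use \<open>w \<noteq> 0\<close> in simp)
  then have "{x. wt x = w} = {x. Tr (x ^ 2) = 0} - {0}" by blast
  then show ?thesis using cnt_0 by (simp add: cnt_def card_Diff_singleton)
qed

section \<open>The code\<close>

definition codeword :: "'q list \<Rightarrow> 'q \<Rightarrow> 'p mod_ring vec" where
  "codeword ds x = vec_of_list (map (\<lambda>d. Tr (x * d)) ds)"

lemma trace_code_eq: "trace_code m ds = range (codeword ds)"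
  by (simp add: trace_code_def codeword_def Tr_def)

lemma dim_codeword [simp]: "dim_vec (codeword ds x) = length ds"
  by (simp add: codeword_def)

lemma codeword_index [simp]: "i < length ds \<Longrightarrow> codeword ds x $ i = Tr (x * ds ! i)"
  by (simp add: codeword_def vec_of_list_index)

lemma subspace_codewords:
  "VectorSpace.subspace class_ring (range (codeword ds)) (module_vec TYPE('p mod_ring) (length ds))"
proof (intro VectorSpace.subspace.intro submodule.intro vec_vs vec_module)
  have add: "codeword ds x + codeword ds y = codeword ds (x + y)" for x y
    by (rule eq_vecI) (simp_all add: distrib_right Tr_add)
  have smult: "a \<cdot>\<^sub>v codeword ds x = codeword ds (emb a * x)" for a x
    by (rule eq_vecI) (simp_all add: Tr_scale mult.assoc)
  have zero: "0\<^sub>v (length ds) = codeword ds 0"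
    by (rule eq_vecI) simp_all
  let ?V = "module_vec TYPE('p mod_ring) (length ds)"
  show "range (codeword ds) \<subseteq> carrier ?V"
    by (auto simp: module_vec_simps intro: carrier_vecI)
  show "v \<oplus>\<^bsub>?V\<^esub> w \<in> range (codeword ds)"
    if "v \<in> range (codeword ds)" "w \<in> range (codeword ds)" for v w
    using that by (auto simp: module_vec_simps add)
  show "\<zero>\<^bsub>?V\<^esub> \<in> range (codeword ds)"
    by (simp add: module_vec_simps zero)
  show "c \<odot>\<^bsub>?V\<^esub> v \<in> range (codeword ds)" if "v \<in> range (codeword ds)" for c v
    using that by (auto simp: module_vec_simps smult)
qed

context
  fixes ds :: "'q list"
  assumes distinct_ds: "distinct ds"
    and set_ds: "set ds = {x. x \<noteq> 0 \<and> Tr (x ^ 2) = 0}"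
begin

lemma length_ds: "length ds = P - 1"
proof -
  have "length ds = card ({x. Tr (x ^ 2) = 0} - {0})"
    using distinct_card[OF distinct_ds] by (simp add: set_ds set_diff_eq conj_commute)
  then show ?thesis using cnt_0 by (simp add: cnt_def card_Diff_singleton)
qed

lemma hamming_weight_codeword: "hamming_weight (codeword ds x) = wt x"
proof -
  have inj: "inj_on ((!) ds) {i. i < length ds \<and> Tr (x * ds ! i) \<noteq> 0}"
    using distinct_ds by (auto intro: inj_on_nth)
  have image: "(!) ds ` {i. i < length ds \<and> Tr (x * ds ! i) \<noteq> 0} = {d \<in> set ds. Tr (x * d) \<noteq> 0}"
    by (auto simp: in_set_conv_nth)
  have "card {i. i < length ds \<and> Tr (x * ds ! i) \<noteq> 0} = card {d \<in> set ds. Tr (x * d) \<noteq> 0}"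
    using card_image[OF inj] by (simp only: image)
  also have "{d \<in> set ds. Tr (x * d) \<noteq> 0} = {y. Tr (y ^ 2) = 0 \<and> Tr (x * y) \<noteq> 0}"
    by (auto simp: set_ds)
  finally show ?thesis by (simp add: hamming_weight_def wt_def cong: conj_cong)
qed

lemma inj_codeword: "inj (codeword ds)"
proof (rule injI)
  fix x y assume eq: "codeword ds x = codeword ds y"
  have "codeword ds (x - y) $ i = 0" if "i < length ds" for i
    using arg_cong[OF eq, of "\<lambda>v. v $ i"] that by (simp add: left_diff_distrib Tr_diff)
  then have "hamming_weight (codeword ds (x - y)) = 0" by (simp add: hamming_weight_def)
  then show "x = y" by (simp add: hamming_weight_codeword wt_eq_0_iff)
qed

lemma weight_count_codewords: "weight_count (range (codeword ds)) w = card {x. wt x = w}"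
proof -
  have "{c \<in> range (codeword ds). hamming_weight c = w} = codeword ds ` {x. wt x = w}"
    by (auto simp: hamming_weight_codeword)
  then show ?thesis
    using inj_codeword by (simp add: weight_count_def card_image inj_on_subset)
qed

text \<open>Injectivity gives \<open>p ^ m\<close> codewords, and a code of dimension
  \<open>k\<close> has \<open>p ^ k\<close> of them.\<close>

lemma linear_code_codewords: "linear_code (length ds) m (range (codeword ds))"
proof -
  let ?V = "module_vec TYPE('p mod_ring) (length ds)\<lparr>carrier := range (codeword ds)\<rparr>"
  have "vectorspace class_ring ?V"
    by (rule vectorspace.subspace_is_vs[OF vec_vs subspace_codewords])
  from vectorspace.card_eq_power_dim[OF this]
  have "card (range (codeword ds)) = p ^ vectorspace.dim class_ring ?V" by simp
  moreover have "card (range (codeword ds)) = p ^ m"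
    using inj_codeword by (simp add: card_image card_q)
  ultimately have "vectorspace.dim class_ring ?V = m"
    using p_gt_2 by (simp add: power_inject_exp)
  then show ?thesis using subspace_codewords by (simp add: linear_code_def)
qed

end

end

theorem theorem1:
  fixes p m n :: nat
    and ds :: "'q::finite_field list"
    and C :: "'p::prime_card mod_ring vec set"
  assumes "prime p" and "odd p" and "m > 1" and "odd m"
    and "CARD('p) = p" and "CARD('q) = p ^ m"
    and "distinct ds"
    and "set ds = {x. x \<noteq> 0 \<and> gf_trace m (x ^ 2) = (0 :: 'p mod_ring)}"
    and "n = length ds"
    and "C = trace_code m ds"
  shows "n = p ^ (m - 1) - 1 \<and>
         linear_code n m C \<and>
         weight_count C 0 = 1 \<and>
         real (weight_count C ((p - 1) * (p ^ (m - 2) - p ^ ((m - 3) div 2)))) =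
           (real p - 1) / 2 * (real p ^ (m - 1) + real p ^ ((m - 1) div 2)) \<and>
         real (weight_count C ((p - 1) * p ^ (m - 2))) = real p ^ (m - 1) - 1 \<and>
         real (weight_count C ((p - 1) * (p ^ (m - 2) + p ^ ((m - 3) div 2)))) =
           (real p - 1) / 2 * (real p ^ (m - 1) - real p ^ ((m - 1) div 2)) \<and>
         (\<forall>w. w \<notin> {0, (p - 1) * (p ^ (m - 2) - p ^ ((m - 3) div 2)), (p - 1) * p ^ (m - 2),
                  (p - 1) * (p ^ (m - 2) + p ^ ((m - 3) div 2))} \<longrightarrow> weight_count C w = 0)"
proof -
  interpret odd_trace m p "gf_trace m :: 'q \<Rightarrow> 'p mod_ring"
    using assms by unfold_locales simp_all
  let ?w1 = "(p - 1) * (p ^ (m - 2) - p ^ ((m - 3) div 2))"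
  let ?w2 = "(p - 1) * p ^ (m - 2)"
  let ?w3 = "(p - 1) * (p ^ (m - 2) + p ^ ((m - 3) div 2))"
  note ds = assms(7,8)
  have C: "C = range (codeword ds)" using assms(10) by (simp add: trace_code_eq)
  have wc: "weight_count C w = card {x. wt x = w}" for w
    by (simp add: C weight_count_codewords[OF ds])
  have p1: "int (p - 1) = int p - 1" using p_gt_2 by simp
  \<comment> \<open>Ensures that the natural-number subtraction in \<open>?w1\<close> is
    exact.\<close>
  have "p ^ ((m - 3) div 2) \<le> p ^ (m - 2)"
    using r_less_P p_gt_2 unfolding P_eq r_eq by simp
  then have w1: "int p * int ?w1 = (int p - 1) * (int P - int r)"
    unfolding of_nat_mult p1 P_eq r_eq by (simp add: of_nat_diff algebra_simps)
  have w2: "int p * int ?w2 = (int p - 1) * int P"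
    unfolding of_nat_mult p1 P_eq by (simp add: algebra_simps)
  have w3: "int p * int ?w3 = (int p - 1) * (int P - - int r)"
    unfolding of_nat_mult p1 P_eq r_eq by (simp add: algebra_simps)
  have half: "real c = (real p - 1) / 2 * (real p ^ (m - 1) + real_of_int e)"
    if "2 * int c = int (p - 1) * (int P + e)" for c e
  proof -
    have "2 * real c = (real p - 1) * (real p ^ (m - 1) + real_of_int e)"
      using arg_cong[OF that, of real_of_int] unfolding p1 by simp
    then show ?thesis by simp
  qed
  have "weight_count C w = 0" if "w \<notin> {0, ?w1, ?w2, ?w3}" for w
  proof -
    have "wt x \<in> {0, ?w1, ?w2, ?w3}" for x
    proof (cases "x = 0")
      case False
      \<comment> \<open>\<open>?w2\<close> is the weight for deviation \<open>0\<close>; the three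
        weights then match the only deviations \<open>r\<close>, \<open>0\<close> and
        \<open>-r\<close>.\<close>
      have "int p * int ?w2 = (int p - 1) * (int P - 0)" using w2 by (simp only: diff_0_right)
      note iffs = wt_eq_iff[OF False w1] wt_eq_iff[OF False this] wt_eq_iff[OF False w3]
      show ?thesis
        using iffs dev_cases[of "gf_trace m (x ^ 2)"] dev_eq_0_iff[of "gf_trace m (x ^ 2)"] by blast
    qed simp
    with that show ?thesis unfolding wc by (metis (mono_tags, lifting) card.empty empty_Collect_eq)
  qed
  moreover have "weight_count C 0 = 1" by (simp add: wc wt_eq_0_iff)
  moreover have "real (weight_count C ?w1)
      = (real p - 1) / 2 * (real p ^ (m - 1) + real p ^ ((m - 1) div 2))"
    using half[OF card_wt_eq[OF disjI1[OF refl] w1]] by (simp add: wc r_def)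
  moreover have "real (weight_count C ?w3)
      = (real p - 1) / 2 * (real p ^ (m - 1) - real p ^ ((m - 1) div 2))"
    using half[OF card_wt_eq[OF disjI2[OF refl] w3]] by (simp add: wc r_def)
  moreover have "real (weight_count C ?w2) = real p ^ (m - 1) - 1"
    unfolding wc card_wt_eq_middle[OF w2] using p_gt_2 by (simp add: of_nat_diff)
  moreover have "n = p ^ (m - 1) - 1" using length_ds[OF ds] assms(9) by simp
  moreover have "linear_code n m C"
    using linear_code_codewords[OF ds] by (simp add: C assms(9))
  ultimately show ?thesis by blast
qed

end
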